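(* With the Alexiewicz norm $\|f\|=\|F\|_\infty$ (where $F\in\mathcal{B}_C$ is the primitive of $f$), the space $\mathcal{A}_C$ of integrable distributions on $\mathbb{R}$ is a Banach space.
   Context: $\mathcal{D}=C_c^\infty(\mathbb{R})$ is the space of real-valued test functions with its usual notion of convergence, and $\mathcal{D}'$ is the space of distributions (continuous linear functionals on $\mathcal{D}$). The derivative of $T\in\mathcal{D}'$ is $\langle T',\phi\rangle=-\langle T,\phi'\rangle$. A locally integrable function $F$ is identified with the distribution $\phi\mapsto\int_{-\infty}^\infty F\phi$. $\overline{\mathbb{R}}=[-\infty,\infty]$ is the two-point compactification of $\mathbb{R}$. $C^0(\overline{\mathbb{R}})$ is the set of continuous real functions $F$ on $\mathbb{R}$ for which the limits at $\pm\infty$ exist in $\mathbb{R}$, extended by $F(\pm\infty)=\lim_{\pm\infty}F$. $$\mathcal{B}_C=\{F\in C^0(\overline{\mathbb{R}}): F(-\infty)=0\},\qquad \mathcal{A}_C=\{f\in\mathcal{D}': f=F' \text{ for some } F\in\mathcal{B}_C\},$$ with $F'$ the distributional derivative. For each $f\in\mathcal{A}_C$ the function $F\in\mathcal{B}_C$ with $F'=f$ is unique and is called the primitive of $f$. Here $\|F\|_\infty=\sup_{\mathbb{R}}|F|$. Vector space operations on $\mathcal{A}_C$ are those of $\mathcal{D}'$. *)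

theory Defs
  imports "HOL-Analysis.Analysis"
begin

section \<open>Test functions\<close>

definition smooth :: "(real \<Rightarrow> real) \<Rightarrow> bool" where
  "smooth \<phi> \<longleftrightarrow> (\<forall>k. (deriv ^^ k) \<phi> differentiable_on UNIV)"

definition supp :: "(real \<Rightarrow> real) \<Rightarrow> real set" where
  "supp \<phi> = closure {x. \<phi> x \<noteq> 0}"

lemma smooth_imp_deriv:
  assumes "smooth \<phi>"
  shows "((deriv ^^ k) \<phi> has_field_derivative (deriv ^^ Suc k) \<phi> x) (at x)"
proof -
  have "(deriv ^^ k) \<phi> differentiable (at x)"
    using assms by (auto simp: smooth_def differentiable_on_def)
  then show ?thesis
    by (simp add: DERIV_deriv_iff_real_differentiable)
qed

lemma smooth_continuous:
  assumes "smooth \<phi>"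
  shows "continuous_on UNIV \<phi>"
  using assms[unfolded smooth_def, rule_format, of 0] by (simp add: differentiable_imp_continuous_on)

lemma deriv_power_lincomb:
  assumes "smooth \<phi>" "smooth \<psi>"
  shows "(deriv ^^ k) (\<lambda>x. a * \<phi> x + b * \<psi> x) =
         (\<lambda>x. a * (deriv ^^ k) \<phi> x + b * (deriv ^^ k) \<psi> x)"
proof (induction k)
  case (Suc k)
  have "deriv (\<lambda>x. a * (deriv ^^ k) \<phi> x + b * (deriv ^^ k) \<psi> x) x
        = a * (deriv ^^ Suc k) \<phi> x + b * (deriv ^^ Suc k) \<psi> x" for x
    by (intro DERIV_imp_deriv DERIV_add DERIV_cmult smooth_imp_deriv assms)
  then show ?case
    by (simp add: Suc.IH fun_eq_iff)
qed simp

lemma smooth_lincomb: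
  assumes "smooth \<phi>" "smooth \<psi>"
  shows "smooth (\<lambda>x. a * \<phi> x + b * \<psi> x)"
proof -
  have "(\<lambda>x. a * (deriv ^^ k) \<phi> x + b * (deriv ^^ k) \<psi> x) differentiable_on UNIV" for k
    using assms unfolding smooth_def by (intro derivative_intros) auto
  then show ?thesis
    by (simp add: smooth_def deriv_power_lincomb[OF assms])
qed

lemma deriv_power_Suc: "(deriv ^^ k) (deriv \<phi>) = (deriv ^^ Suc k) \<phi>"
  by (simp only: funpow_Suc_right comp_def)

lemma smooth_deriv: "smooth \<phi> \<Longrightarrow> smooth (deriv \<phi>)"
  unfolding smooth_def deriv_power_Suc by blast

lemma not_in_supp: "x \<notin> supp \<phi> \<Longrightarrow> \<phi> x = 0"
  unfolding supp_def using closure_subset[of "{x. \<phi> x \<noteq> 0}"] by blast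

lemma compact_supp_subset: "compact K \<Longrightarrow> supp \<psi> \<subseteq> K \<Longrightarrow> compact (supp \<psi>)"
  by (metis Int_absorb1 closed_closure compact_Int_closed supp_def)

lemma supp_lincomb: "supp (\<lambda>x. a * \<phi> x + b * \<psi> x) \<subseteq> supp \<phi> \<union> supp \<psi>"
  unfolding supp_def closure_Un[symmetric] by (rule closure_mono) auto

lemma supp_deriv: "supp (deriv \<phi>) \<subseteq> supp \<phi>"
proof -
  have "deriv \<phi> x = 0" if "x \<notin> supp \<phi>" for x
  proof -
    have "eventually (\<lambda>y. y \<in> - supp \<phi>) (nhds x)"
      using that by (intro eventually_nhds_in_open) (auto simp: supp_def)
    then have "eventually (\<lambda>y. \<phi> y = 0) (nhds x)"
      by eventually_elim (auto intro: not_in_supp)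
    then have "deriv \<phi> x = deriv (\<lambda>_. 0) x"
      by (rule deriv_cong_ev) simp
    then show ?thesis by simp
  qed
  then have "{x. deriv \<phi> x \<noteq> 0} \<subseteq> supp \<phi>" by blast
  then show ?thesis
    unfolding supp_def[of "deriv \<phi>"] by (rule closure_minimal) (simp add: supp_def)
qed

typedef test_fun = "{\<phi> :: real \<Rightarrow> real. smooth \<phi> \<and> compact (supp \<phi>)}"
  morphisms test_apply Abs_test_fun
proof (rule exI)
  have "(deriv ^^ k) (\<lambda>_::real. 0::real) = (\<lambda>_. 0)" for k
    by (induction k) auto
  then show "(\<lambda>_. 0) \<in> {\<phi> :: real \<Rightarrow> real. smooth \<phi> \<and> compact (supp \<phi>)}"
    by (simp add: smooth_def supp_def)
qed

setup_lifting type_definition_test_fun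

lemma test_lincomb:
  assumes "smooth \<phi> \<and> compact (supp \<phi>)" "smooth \<psi> \<and> compact (supp \<psi>)"
  shows "smooth (\<lambda>x. a * \<phi> x + b * \<psi> x) \<and> compact (supp (\<lambda>x. a * \<phi> x + b * \<psi> x))"
  using assms smooth_lincomb compact_supp_subset[OF compact_Un supp_lincomb] by blast

instantiation test_fun :: real_vector
begin

lift_definition zero_test_fun :: test_fun is "\<lambda>_. 0"
  using test_apply[of undefined] test_lincomb[of "test_apply undefined" "test_apply undefined" 0 0]
  by simp

lift_definition plus_test_fun :: "test_fun \<Rightarrow> test_fun \<Rightarrow> test_fun" is "\<lambda>\<phi> \<psi> x. \<phi> x + \<psi> x"
  subgoal for \<phi> \<psi> using test_lincomb[of \<phi> \<psi> 1 1] by simp done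

lift_definition minus_test_fun :: "test_fun \<Rightarrow> test_fun \<Rightarrow> test_fun" is "\<lambda>\<phi> \<psi> x. \<phi> x - \<psi> x"
  subgoal for \<phi> \<psi> using test_lincomb[of \<phi> \<psi> 1 "-1"] by simp done

lift_definition uminus_test_fun :: "test_fun \<Rightarrow> test_fun" is "\<lambda>\<phi> x. - \<phi> x"
  subgoal for \<phi> using test_lincomb[of \<phi> \<phi> "-1" 0] by simp done

lift_definition scaleR_test_fun :: "real \<Rightarrow> test_fun \<Rightarrow> test_fun" is "\<lambda>c \<phi> x. c * \<phi> x"
  subgoal for c \<phi> using test_lincomb[of \<phi> \<phi> c 0] by simp done

instance
  by standard (transfer; simp add: fun_eq_iff algebra_simps)+

end

lift_definition test_deriv :: "test_fun \<Rightarrow> test_fun" is deriv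
  using smooth_deriv compact_supp_subset[OF _ supp_deriv] by blast

definition test_tendsto :: "(nat \<Rightarrow> test_fun) \<Rightarrow> test_fun \<Rightarrow> bool" where
  "test_tendsto \<Phi> \<phi> \<longleftrightarrow>
     (\<exists>K. compact K \<and> (\<forall>n. supp (test_apply (\<Phi> n)) \<subseteq> K)) \<and>
     (\<forall>k. uniform_limit UNIV (\<lambda>n. (deriv ^^ k) (test_apply (\<Phi> n)))
            ((deriv ^^ k) (test_apply \<phi>)) sequentially)"

lemma test_deriv_add: "test_deriv (\<phi> + \<psi>) = test_deriv \<phi> + test_deriv \<psi>"
  apply transfer
  subgoal for \<phi> \<psi> using deriv_power_lincomb[of \<phi> \<psi> 1 1 1] by simp
  done

lemma test_deriv_scaleR: "test_deriv (c *\<^sub>R \<phi>) = c *\<^sub>R test_deriv \<phi>"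
  apply transfer
  subgoal for c \<phi> using deriv_power_lincomb[of \<phi> \<phi> 1 c 0] by simp
  done

lemma test_tendsto_deriv:
  assumes "test_tendsto \<Phi> \<phi>"
  shows "test_tendsto (\<lambda>n. test_deriv (\<Phi> n)) (test_deriv \<phi>)"
proof -
  obtain K where K: "compact K" "\<And>n. supp (test_apply (\<Phi> n)) \<subseteq> K"
    using assms by (auto simp: test_tendsto_def)
  have "supp (test_apply (test_deriv (\<Phi> n))) \<subseteq> K" for n
    unfolding test_deriv.rep_eq using supp_deriv K(2) by (rule subset_trans)
  moreover have "uniform_limit UNIV (\<lambda>n. (deriv ^^ k) (test_apply (test_deriv (\<Phi> n))))
            ((deriv ^^ k) (test_apply (test_deriv \<phi>))) sequentially" for k
    unfolding test_deriv.rep_eq deriv_power_Suc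
    using assms unfolding test_tendsto_def by blast
  ultimately show ?thesis
    unfolding test_tendsto_def using K(1) by blast
qed

section \<open>Distributions\<close>

typedef distribution =
  "{T :: test_fun \<Rightarrow> real. linear T \<and>
      (\<forall>\<Phi> \<phi>. test_tendsto \<Phi> \<phi> \<longrightarrow> (\<lambda>n. T (\<Phi> n)) \<longlonglongrightarrow> T \<phi>)}"
  morphisms distr_apply Abs_distribution
  by (rule exI[of _ "\<lambda>_. 0"]) (simp add: linear_zero)

setup_lifting type_definition_distribution

instantiation distribution :: real_vector
begin

lift_definition zero_distribution :: distribution is "\<lambda>_. 0"
  by (simp add: linear_zero)

lift_definition plus_distribution :: "distribution \<Rightarrow> distribution \<Rightarrow> distribution"
  is "\<lambda>S T \<phi>. S \<phi> + T \<phi>"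
  by (auto intro!: linear_compose_add tendsto_add)

lift_definition minus_distribution :: "distribution \<Rightarrow> distribution \<Rightarrow> distribution"
  is "\<lambda>S T \<phi>. S \<phi> - T \<phi>"
  by (auto intro!: linear_compose_sub tendsto_diff)

lift_definition uminus_distribution :: "distribution \<Rightarrow> distribution" is "\<lambda>T \<phi>. - T \<phi>"
  by (auto intro!: linear_compose_neg tendsto_minus)

lift_definition scaleR_distribution :: "real \<Rightarrow> distribution \<Rightarrow> distribution"
  is "\<lambda>c T \<phi>. c * T \<phi>"
  by (auto intro!: tendsto_mult_left linear_compose_scale_right[where 'b = real, simplified])

instance
  by standard (transfer; simp add: fun_eq_iff algebra_simps)+

end

lift_definition distr_deriv :: "distribution \<Rightarrow> distribution"
  is "\<lambda>T \<phi>. - T (test_deriv \<phi>)"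
  subgoal for T
    using test_tendsto_deriv by (auto intro!: tendsto_minus
      simp: linear_iff test_deriv_add test_deriv_scaleR)
  done

definition locally_integrable :: "(real \<Rightarrow> real) \<Rightarrow> bool" where
  "locally_integrable F \<longleftrightarrow> (\<forall>K. compact K \<longrightarrow> F absolutely_integrable_on K)"

lemma integrable_mult_test:
  assumes "locally_integrable F"
  shows "integrable lebesgue (\<lambda>x. F x * test_apply \<phi> x)"
proof -
  define K where "K = supp (test_apply \<phi>)"
  have K: "compact K" and s: "smooth (test_apply \<phi>)"
    using test_apply[of \<phi>] by (auto simp: K_def)
  have c: "continuous_on UNIV (test_apply \<phi>)"
    using s by (rule smooth_continuous)
  have FK: "integrable lebesgue (\<lambda>x. indicator K x * F x)"
    using assms K unfolding locally_integrable_def set_integrable_def by simp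
  have "bounded (test_apply \<phi> ` K)"
    using K c by (meson compact_continuous_image compact_imp_bounded continuous_on_subset subset_UNIV)
  then obtain C where C: "\<And>x. x \<in> K \<Longrightarrow> \<bar>test_apply \<phi> x\<bar> \<le> C"
    unfolding bounded_iff by auto
  have eq: "F x * test_apply \<phi> x = indicator K x * F x * test_apply \<phi> x" for x
    by (cases "x \<in> K") (auto simp: K_def not_in_supp)
  have "test_apply \<phi> \<in> borel_measurable lebesgue"
    using borel_measurable_continuous_onI[OF c] by (intro measurable_completion) simp
  then have "(\<lambda>x. indicator K x * F x * test_apply \<phi> x) \<in> borel_measurable lebesgue"
    using borel_measurable_integrable[OF FK] by (rule borel_measurable_times[rotated])
  moreover have "norm (indicator K x * F x * test_apply \<phi> x) \<le> norm (C * (indicator K x * F x))" for x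
  proof (cases "x \<in> K")
    case True
    have "\<bar>F x\<bar> * \<bar>test_apply \<phi> x\<bar> \<le> \<bar>F x\<bar> * \<bar>C\<bar>"
      using C[OF True] by (intro mult_left_mono) auto
    then show ?thesis using True by (simp add: abs_mult mult.commute)
  qed simp
  ultimately have "integrable lebesgue (\<lambda>x. indicator K x * F x * test_apply \<phi> x)"
    by (intro Bochner_Integration.integrable_bound[OF integrable_mult_right[OF FK, of C]] AE_I2)
  then show ?thesis
    by (simp only: eq)
qed

lemma tendsto_integral_test:
  assumes F: "locally_integrable F" and lim: "test_tendsto \<Phi> \<phi>"
  shows "(\<lambda>n. \<integral>x. F x * test_apply (\<Phi> n) x \<partial>lebesgue) \<longlonglongrightarrow> (\<integral>x. F x * test_apply \<phi> x \<partial>lebesgue)"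
proof -
  obtain K where K: "compact K" and sK: "\<And>n. supp (test_apply (\<Phi> n)) \<subseteq> K"
    using lim by (auto simp: test_tendsto_def)
  have ul: "uniform_limit UNIV (\<lambda>n. test_apply (\<Phi> n)) (test_apply \<phi>) sequentially"
    using lim[unfolded test_tendsto_def] by (auto dest!: conjunct2 spec[of _ 0])
  have out: "test_apply (\<Phi> n) x = 0" if "x \<notin> K" for n x
    using that sK not_in_supp by blast
  have out': "test_apply \<phi> x = 0" if "x \<notin> K" for x
    using tendsto_uniform_limitI[OF ul, of x] out[OF that] by (simp add: LIMSEQ_const_iff)
  have "set_integrable lebesgue K F"
    using F K unfolding locally_integrable_def by simp
  then have FK: "integrable lebesgue (\<lambda>x. \<bar>indicator K x * F x\<bar>)"
    unfolding set_integrable_def by (intro integrable_abs) simp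
  define B where "B = (\<integral>x. \<bar>indicator K x * F x\<bar> \<partial>lebesgue)"
  have B: "B \<ge> 0" unfolding B_def by (rule integral_nonneg_AE) simp
  show ?thesis
  proof (rule LIMSEQ_I)
    fix r :: real assume r: "r > 0"
    define e where "e = r / (B + 1)"
    have e: "e > 0" and eB: "e * B < r"
      using r B by (auto simp: e_def field_simps)
    obtain N where N: "\<And>n x. n \<ge> N \<Longrightarrow> \<bar>test_apply (\<Phi> n) x - test_apply \<phi> x\<bar> < e"
      using uniform_limitD[OF ul e] by (auto simp: eventually_sequentially dist_real_def)
    show "\<exists>N. \<forall>n\<ge>N. norm ((\<integral>x. F x * test_apply (\<Phi> n) x \<partial>lebesgue) - (\<integral>x. F x * test_apply \<phi> x \<partial>lebesgue)) < r"
    proof (intro exI allI impI)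
      fix n assume n: "n \<ge> N"
      have i: "integrable lebesgue (\<lambda>x. F x * test_apply (\<Phi> n) x - F x * test_apply \<phi> x)"
        by (intro Bochner_Integration.integrable_diff integrable_mult_test F)
      have "norm (\<integral>x. F x * test_apply (\<Phi> n) x - F x * test_apply \<phi> x \<partial>lebesgue)
            \<le> (\<integral>x. norm (F x * test_apply (\<Phi> n) x - F x * test_apply \<phi> x) \<partial>lebesgue)"
        by (rule integral_norm_bound)
      also have "\<dots> \<le> (\<integral>x. e * \<bar>indicator K x * F x\<bar> \<partial>lebesgue)"
      proof (rule integral_mono)
        show "integrable lebesgue (\<lambda>x. norm (F x * test_apply (\<Phi> n) x - F x * test_apply \<phi> x))"
          using i by (rule integrable_norm)
        show "integrable lebesgue (\<lambda>x. e * \<bar>indicator K x * F x\<bar>)"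
          using FK by (rule integrable_mult_right)
        fix x
        show "norm (F x * test_apply (\<Phi> n) x - F x * test_apply \<phi> x) \<le> e * \<bar>indicator K x * F x\<bar>"
        proof (cases "x \<in> K")
          case True
          have "\<bar>F x\<bar> * \<bar>test_apply (\<Phi> n) x - test_apply \<phi> x\<bar> \<le> \<bar>F x\<bar> * e"
            using N[OF n, of x] by (intro mult_left_mono) auto
          then show ?thesis
            using True by (simp add: abs_mult mult.commute flip: right_diff_distrib)
        qed (simp add: out out')
      qed
      also have "\<dots> = e * B" by (simp add: B_def)
      finally show "norm ((\<integral>x. F x * test_apply (\<Phi> n) x \<partial>lebesgue) - (\<integral>x. F x * test_apply \<phi> x \<partial>lebesgue)) < r"
        using eB by (simp add: Bochner_Integration.integral_diff integrable_mult_test F)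
    qed
  qed
qed

text \<open>The identification of locally integrable functions with distributions; functions that are
  not locally integrable are sent to the zero distribution.\<close>

lift_definition distr_of_fun :: "(real \<Rightarrow> real) \<Rightarrow> distribution"
  is "\<lambda>F \<phi>. if locally_integrable F then \<integral>x. F x * test_apply \<phi> x \<partial>lebesgue else 0"
  subgoal for F
  proof (cases "locally_integrable F")
    case True
    have "linear (\<lambda>\<phi>. \<integral>x. F x * test_apply \<phi> x \<partial>lebesgue)"
    proof (rule linearI)
      fix \<phi> \<psi> and c :: real
      show "(\<integral>x. F x * test_apply (\<phi> + \<psi>) x \<partial>lebesgue)
            = (\<integral>x. F x * test_apply \<phi> x \<partial>lebesgue) + (\<integral>x. F x * test_apply \<psi> x \<partial>lebesgue)"
        unfolding plus_test_fun.rep_eq distrib_left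
        by (intro Bochner_Integration.integral_add integrable_mult_test True)
      show "(\<integral>x. F x * test_apply (c *\<^sub>R \<phi>) x \<partial>lebesgue)
            = c *\<^sub>R (\<integral>x. F x * test_apply \<phi> x \<partial>lebesgue)"
        by (simp add: scaleR_test_fun.rep_eq mult.left_commute)
    qed
    then show ?thesis
      using True tendsto_integral_test[OF True] by simp
  qed (simp add: linear_zero)
  done

lemma continuous_imp_locally_integrable:
  "continuous_on UNIV F \<Longrightarrow> locally_integrable F"
proof -
  assume c: "continuous_on UNIV F"
  show "locally_integrable F"
    unfolding locally_integrable_def
  proof (intro allI impI)
    fix K :: "real set" assume K: "compact K"
    obtain a b where "K \<subseteq> {a..b}"
      using compact_imp_bounded[OF K] bounded_subset_cbox_symmetric by (metis cbox_interval)
    moreover have "F absolutely_integrable_on {a..b}"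
      using c by (intro absolutely_integrable_continuous_real) (rule continuous_on_subset, auto)
    ultimately show "F absolutely_integrable_on K"
      using K by (meson set_integrable_subset lmeasurable_compact fmeasurableD)
  qed
qed

lemma distr_of_fun_continuous:
  assumes "continuous_on UNIV F"
  shows "distr_apply (distr_of_fun F) \<phi> = (\<integral>x. F x * test_apply \<phi> x \<partial>lebesgue)"
  using continuous_imp_locally_integrable[OF assms] by (simp add: distr_of_fun.rep_eq)

section \<open>Integrable distributions and the Alexiewicz norm\<close>

text \<open>Continuous functions on the extended real line are represented by their restrictions to
  the reals; the values at the two infinite points are the (unique) limits there.\<close>

definition C0_ext :: "(real \<Rightarrow> real) set" where
  "C0_ext = {F. continuous_on UNIV F \<and> (\<exists>l. (F \<longlongrightarrow> l) at_bot) \<and> (\<exists>l. (F \<longlongrightarrow> l) at_top)}"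

definition B_C :: "(real \<Rightarrow> real) set" where
  "B_C = {F \<in> C0_ext. (F \<longlongrightarrow> 0) at_bot}"

definition A_C :: "distribution set" where
  "A_C = {f. \<exists>F \<in> B_C. f = distr_deriv (distr_of_fun F)}"

definition primitive :: "distribution \<Rightarrow> real \<Rightarrow> real" where
  "primitive f = (THE F. F \<in> B_C \<and> distr_deriv (distr_of_fun F) = f)"

definition alexiewicz_norm :: "distribution \<Rightarrow> real" where
  "alexiewicz_norm f = (SUP x. \<bar>primitive f x\<bar>)"

section \<open>Banach spaces carried by a set\<close>

definition norm_on :: "'a::real_vector set \<Rightarrow> ('a \<Rightarrow> real) \<Rightarrow> bool" where
  "norm_on V N \<longleftrightarrow>
     (\<forall>x\<in>V. 0 \<le> N x) \<and>
     (\<forall>x\<in>V. N x = 0 \<longleftrightarrow> x = 0) \<and>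
     (\<forall>c. \<forall>x\<in>V. N (c *\<^sub>R x) = \<bar>c\<bar> * N x) \<and>
     (\<forall>x\<in>V. \<forall>y\<in>V. N (x + y) \<le> N x + N y)"

definition complete_norm_on :: "'a::real_vector set \<Rightarrow> ('a \<Rightarrow> real) \<Rightarrow> bool" where
  "complete_norm_on V N \<longleftrightarrow>
     (\<forall>s. (\<forall>n. s n \<in> V) \<and> (\<forall>e>0. \<exists>M. \<forall>m\<ge>M. \<forall>n\<ge>M. N (s m - s n) < e) \<longrightarrow>
        (\<exists>l\<in>V. (\<lambda>n::nat. N (s n - l)) \<longlonglongrightarrow> 0))"

definition banach_space_on :: "'a::real_vector set \<Rightarrow> ('a \<Rightarrow> real) \<Rightarrow> bool" where
  "banach_space_on V N \<longleftrightarrow> subspace V \<and> norm_on V N \<and> complete_norm_on V N"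

end

theory Submission
  imports Defs "HOL-Computational_Algebra.Polynomial"
begin

text \<open>
  The map $F \mapsto F'$ is linear from \<open>B_C\<close> onto \<open>A_C\<close>, and \<open>B_C\<close> with the supremum norm is
  complete because uniform limits preserve continuity and the limits at $\pm\infty$. What remains
  is injectivity: if $F' = 0$ then $F$ is constant. A test function with integral $0$ has an
  antiderivative that is again a test function, so $F' = 0$ makes \<open>F\<close> annihilate every such
  function. Applied to the difference of two normalised bumps concentrated near \<open>x\<close> and \<open>y\<close>, this
  gives $F(x) = F(y)$.
\<close>

subsection \<open>Bump functions\<close>

text \<open>Since \<open>S\<close> is closed under differentiation, all iterates of
  \<open>deriv\<close> on \<open>f\<close> stay in \<open>S\<close>, whose members are
  differentiable. This avoids any formula for the k-th derivative of a bump.\<close>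

lemma smooth_if_derivs:
  assumes "f \<in> S" and "\<And>g. g \<in> S \<Longrightarrow> \<exists>g'\<in>S. \<forall>x. (g has_field_derivative g' x) (at x)"
  shows "smooth f"
proof -
  have deriv: "deriv g \<in> S" and diff: "g differentiable_on UNIV" if "g \<in> S" for g
  proof -
    obtain g' where g': "g' \<in> S" "\<And>x. (g has_field_derivative g' x) (at x)"
      using assms(2) \<open>g \<in> S\<close> by meson
    then have "deriv g = g'"
      by (intro ext DERIV_imp_deriv)
    then show "deriv g \<in> S" using g' by simp
    show "g differentiable_on UNIV"
      using g'(2) real_differentiable_def by (auto simp: differentiable_on_def)
  qed
  have "(deriv ^^ k) f \<in> S" for k
    by (induction k) (use assms(1) deriv in auto)
  then show ?thesis
    using diff by (auto simp: smooth_def)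
qed

text \<open>The classical bump is the case \<open>p = 1\<close>, \<open>n = 0\<close>. The
  polynomial numerator and the power in the denominator make the family, for fixed \<open>a\<close>
  and \<open>c\<close>, closed under differentiation.\<close>

definition poly_bump :: "real \<Rightarrow> real \<Rightarrow> real poly \<Rightarrow> nat \<Rightarrow> real \<Rightarrow> real" where
  "poly_bump a c p n x =
     (if a < x \<and> x < c then poly p x * exp (- 1 / ((x - a) * (c - x))) / ((x - a) * (c - x)) ^ n else 0)"

text \<open>With t = 1/q and N = n + 2, (t/N)^N <= (1 + t/N)^N <= exp t. Taking reciprocals bounds
  exp(-1/q) by (N q)^N; dividing by q^n leaves the square.\<close>

lemma exp_minus_inverse_over_power_le:
  fixes q :: real
  assumes "0 < q"
  shows "exp (- 1 / q) / q ^ n \<le> real (n + 2) ^ (n + 2) * q\<^sup>2"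
proof -
  have "(1 / q / real (n + 2)) ^ (n + 2) \<le> (1 + 1 / q / real (n + 2)) ^ (n + 2)"
    using assms by (intro power_mono) auto
  also have "\<dots> \<le> exp (1 / q)"
    using assms less_le_trans[of "-1" 0 "1 / q"]
    by (intro exp_ge_one_plus_x_over_n_power_n) auto
  finally have "1 / (q ^ (n + 2) * real (n + 2) ^ (n + 2)) \<le> exp (1 / q)"
    by (simp only: power_divide power_one divide_divide_eq_left power_mult_distrib)
  then have "exp (- (1 / q)) \<le> q ^ (n + 2) * real (n + 2) ^ (n + 2)"
    using assms le_imp_inverse_le[of "1 / (q ^ (n + 2) * real (n + 2) ^ (n + 2))" "exp (1 / q)"]
    unfolding exp_minus by simp
  then show ?thesis
    using assms by (simp add: divide_le_eq power_add power2_eq_square mult_ac)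
qed

text \<open>Quadratic decay at both endpoints of the support makes the derivative vanish there.\<close>

lemma poly_bump_quadratic_bound:
  assumes "e = a \<or> e = c"
  obtains K where "\<And>x. \<bar>poly_bump a c p n x\<bar> \<le> K * (x - e)\<^sup>2"
proof -
  have "bounded (poly p ` {a..c})"
    by (intro compact_imp_bounded compact_continuous_image continuous_intros compact_Icc)
  then obtain M where M: "M > 0" "\<And>x. x \<in> {a..c} \<Longrightarrow> \<bar>poly p x\<bar> \<le> M"
    unfolding bounded_pos by auto
  define R where "R = M * real (n + 2) ^ (n + 2)"
  have R: "R \<ge> 0" using M by (simp add: R_def)
  have "\<bar>poly_bump a c p n x\<bar> \<le> (R * (c - a)\<^sup>2) * (x - e)\<^sup>2" for x
  proof (cases "a < x \<and> x < c")
    case True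
    define q where "q = (x - a) * (c - x)"
    have q: "q > 0" using True by (simp add: q_def)
    \<comment> \<open>One factor of \<open>q\<close> is the distance to the endpoint
      \<open>e\<close>; the other is at most the length of the interval.\<close>
    have "q \<le> (c - a) * \<bar>x - e\<bar>"
    proof (cases "e = a")
      case True
      then show ?thesis
        using \<open>a < x \<and> x < c\<close> mult_right_mono[of "c - x" "c - a" "x - a"] by (simp add: q_def mult.commute)
    next
      case False
      then have "e = c" using assms by simp
      then show ?thesis
        using True mult_right_mono[of "x - a" "c - a" "c - x"] by (simp add: q_def)
    qed
    then have "q\<^sup>2 \<le> ((c - a) * \<bar>x - e\<bar>)\<^sup>2"
      using q by (intro power_mono) auto
    then have q2: "q\<^sup>2 \<le> (c - a)\<^sup>2 * (x - e)\<^sup>2"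
      by (simp add: power_mult_distrib)
    have "\<bar>poly_bump a c p n x\<bar> = \<bar>poly p x\<bar> * (exp (- 1 / q) / q ^ n)"
      using True q by (simp add: poly_bump_def abs_mult flip: q_def)
    also have "\<dots> \<le> M * (real (n + 2) ^ (n + 2) * q\<^sup>2)"
      using q True M by (intro mult_mono exp_minus_inverse_over_power_le) auto
    also have "\<dots> = R * q\<^sup>2" by (simp add: R_def)
    also have "\<dots> \<le> R * ((c - a)\<^sup>2 * (x - e)\<^sup>2)"
      using q2 R by (rule mult_left_mono)
    finally show ?thesis by (simp add: mult.assoc)
  next
    case False
    then have "poly_bump a c p n x = 0" by (auto simp: poly_bump_def)
    then show ?thesis using R by simp
  qed
  then show ?thesis by (rule that)
qed

lemma has_field_derivative_zero_quadratic:
  fixes f :: "real \<Rightarrow> real"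
  assumes "\<And>x. \<bar>f x\<bar> \<le> K * (x - e)\<^sup>2"
  shows "(f has_field_derivative 0) (at e)"
proof -
  have fe: "f e = 0" using assms[of e] by simp
  have "norm ((f x - f e) / (x - e)) \<le> K * \<bar>x - e\<bar>" if "x \<noteq> e" for x
    using assms[of x] that by (simp add: fe divide_le_eq power2_eq_square mult.assoc)
  then have "eventually (\<lambda>x. norm ((f x - f e) / (x - e)) \<le> K * \<bar>x - e\<bar>) (at e)"
    by (simp add: eventually_at_filter)
  moreover have "((\<lambda>x. K * \<bar>x - e\<bar>) \<longlongrightarrow> 0) (at e)"
    by (auto intro!: tendsto_eq_intros)
  ultimately have "((\<lambda>x. (f x - f e) / (x - e)) \<longlongrightarrow> 0) (at e)"
    by (rule Lim_null_comparison)
  then show ?thesis by (simp add: has_field_derivative_iff)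
qed

text \<open>Inside the interval this is the quotient rule over the common denominator
  \<open>Q ^ (n + 2)\<close>: the summands of \<open>p'\<close> come from \<open>p\<close>, from
  \<open>Q ^ n\<close> and from the exponential. At the endpoints the quadratic bound gives
  derivative zero, and outside the closed interval the function is locally zero.\<close>

lemma poly_bump_deriv:
  fixes p :: "real poly" and a c :: real and n :: nat
  defines "Q \<equiv> [:-a, 1:] * [:c, -1:]"
  defines "p' \<equiv> pderiv p * Q\<^sup>2 - smult (real n) (p * Q * pderiv Q) + p * pderiv Q"
  shows "(poly_bump a c p n has_field_derivative poly_bump a c p' (n + 2) x) (at x)"
proof -
  have Q: "poly Q x = (x - a) * (c - x)" for x
    by (simp add: Q_def algebra_simps)
  consider "a < x \<and> x < c" | "x = a \<or> x = c" | "x < a \<or> x > c" by linarith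
  then show ?thesis
  proof cases
    case 1
    then have pos: "poly Q x > 0" by (simp add: Q)
    have "((\<lambda>x. poly p x * exp (- 1 / poly Q x) / poly Q x ^ n) has_field_derivative
            poly p' x * exp (- 1 / poly Q x) / poly Q x ^ (n + 2)) (at x)"
    proof -
      \<comment> \<open>The power rule produces the truncated exponent \<open>n - 1\<close>; for
        \<open>n = 0\<close> the factor \<open>real n\<close> makes both sides vanish.\<close>
      have "real n * poly Q x ^ (n - 1) = real n * poly Q x ^ n / poly Q x"
        using pos by (cases n) auto
      then show ?thesis
        using pos by (auto intro!: derivative_eq_intros poly_DERIV simp: p'_def field_simps power2_eq_square)
    qed
    then have "((\<lambda>x. poly p x * exp (- 1 / poly Q x) / poly Q x ^ n) has_field_derivative
            poly_bump a c p' (n + 2) x) (at x)"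
      using 1 by (simp add: poly_bump_def flip: Q)
    then show ?thesis
      by (rule has_field_derivative_transform_within_open[where S = "{a<..<c}"])
         (use 1 in \<open>auto simp: poly_bump_def Q\<close>)
  next
    case 2
    obtain K where "\<And>y. \<bar>poly_bump a c p n y\<bar> \<le> K * (y - x)\<^sup>2"
      using poly_bump_quadratic_bound[OF 2] by metis
    then have "(poly_bump a c p n has_field_derivative 0) (at x)"
      by (rule has_field_derivative_zero_quadratic)
    then show ?thesis using 2 by (auto simp: poly_bump_def)
  next
    case 3
    have "((\<lambda>_. 0) has_field_derivative 0) (at x)" by simp
    then have "(poly_bump a c p n has_field_derivative 0) (at x)"
      by (rule has_field_derivative_transform_within_open[where S = "- {a..c}"])
         (use 3 in \<open>auto simp: poly_bump_def\<close>)
    then show ?thesis using 3 by (auto simp: poly_bump_def)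
  qed
qed

lemma smooth_poly_bump: "smooth (poly_bump a c p n)"
proof (rule smooth_if_derivs)
  let ?S = "{poly_bump a c p n | p n. True}"
  show "poly_bump a c p n \<in> ?S" by blast
  show "\<exists>g'\<in>?S. \<forall>x. (g has_field_derivative g' x) (at x)" if "g \<in> ?S" for g
    using that poly_bump_deriv by blast
qed

lemma supp_subset_Icc:
  assumes "\<And>x. x \<notin> {u..v} \<Longrightarrow> \<phi> x = 0"
  shows "supp \<phi> \<subseteq> {u..v}"
  unfolding supp_def by (rule closure_minimal) (use assms in \<open>blast, simp\<close>)

lemma ex_nonneg_test_fun:
  fixes a c :: real
  assumes "a < c"
  obtains \<phi> where "\<And>x. 0 \<le> test_apply \<phi> x" "\<And>x. test_apply \<phi> x \<noteq> 0 \<longleftrightarrow> x \<in> {a<..<c}"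
proof -
  let ?b = "poly_bump a c 1 0"
  have "supp ?b \<subseteq> {a..c}"
    by (rule supp_subset_Icc) (auto simp: poly_bump_def)
  then have "compact (supp ?b)"
    by (rule compact_supp_subset[rotated]) simp
  then have "test_apply (Abs_test_fun ?b) = ?b"
    by (simp add: Abs_test_fun_inverse smooth_poly_bump)
  then show ?thesis
    by (intro that[of "Abs_test_fun ?b"]) (auto simp: poly_bump_def)
qed

subsection \<open>Distributions with zero derivative\<close>

lemma integrable_test: "integrable lebesgue (test_apply \<phi>)"
  using integrable_mult_test[of "\<lambda>_. 1" \<phi>] by (simp add: continuous_imp_locally_integrable)

lemma continuous_test: "continuous_on A (test_apply \<phi>)"
  using smooth_continuous[of "test_apply \<phi>"] test_apply[of \<phi>] continuous_on_subset by blast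

lemma test_vanishes_outside:
  obtains R where "R > 0" "\<And>x. x \<notin> {-R..R} \<Longrightarrow> test_apply \<phi> x = 0"
proof -
  have "bounded (supp (test_apply \<phi>))"
    using test_apply[of \<phi>] by (auto intro: compact_imp_bounded)
  then obtain R where "R > 0" "\<And>x. x \<in> supp (test_apply \<phi>) \<Longrightarrow> \<bar>x\<bar> \<le> R"
    unfolding bounded_pos by auto
  then show ?thesis
    using not_in_supp by (intro that[of R]) force+
qed

text \<open>An antiderivative of \<open>\<eta>\<close> is constant on each side of the support.
  Normalising it to vanish on the left, the zero integral makes it vanish on the right as well, so
  its support is compact.\<close>

lemma test_fun_integral_zero_imp_deriv:
  assumes int0: "(\<integral>x. test_apply \<eta> x \<partial>lebesgue) = 0"
  obtains \<psi> where "test_deriv \<psi> = \<eta>"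
proof -
  let ?c = "test_apply \<eta>"
  obtain R where R: "R > 0" "\<And>x. x \<notin> {-R..R} \<Longrightarrow> ?c x = 0"
    using test_vanishes_outside[of \<eta>] by metis
  have "\<exists>g. \<forall>x::real. -\<infinity> < ereal x \<longrightarrow> ereal x < \<infinity> \<longrightarrow> (g has_vector_derivative ?c x) (at x)"
    using continuous_test[of UNIV \<eta>]
    by (intro einterval_antiderivative) (auto simp: continuous_on_eq_continuous_at)
  then obtain g where g: "\<And>x. (g has_field_derivative ?c x) (at x)"
    by (auto simp: has_real_derivative_iff_has_vector_derivative)
  have "(?c has_integral (g R - g (-R))) {-R..R}"
    using R g by (intro fundamental_theorem_of_calculus)
      (auto simp: has_real_derivative_iff_has_vector_derivative intro: has_vector_derivative_at_within)
  \<comment> \<open>The fundamental theorem gives a gauge integral over \<open>{-R..R}\<close>,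
    while \<open>int0\<close> is about a Lebesgue integral. Both become gauge integrals over the
    whole line, where uniqueness equates them.\<close>
  then have "(?c has_integral (g R - g (-R))) UNIV"
    by (rule has_integral_on_superset) (use R in auto)
  moreover have "(?c has_integral 0) UNIV"
    using has_integral_integral_lebesgue[OF integrable_test[of \<eta>]] int0 by simp
  ultimately have "g R - g (-R) = 0"
    by (rule has_integral_unique)
  then have gR: "g R = g (-R)" by simp
  define h where "h = (\<lambda>x. g x - g (-R))"
  have h: "(h has_field_derivative ?c x) (at x)" for x
    unfolding h_def using g[of x] by (auto intro!: derivative_eq_intros)
  have h0: "(h has_field_derivative 0) (at x)" if "x \<notin> {-R..R}" for x
    using h[of x] R(2)[OF that] by simp
  have "h x = 0" if "x \<notin> {-R..R}" for x
  proof (cases "x > R")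
    case True
    have "h x = h R"
    proof (rule DERIV_isconst2[of R x])
      show "continuous_on {R..x} h"
        using h by (meson DERIV_isCont continuous_at_imp_continuous_on)
    qed (use True h0 R(1) in auto)
    then show ?thesis by (simp add: h_def gR)
  next
    case False
    then have lt: "x < -R" using that by auto
    have "h (-R) = h x"
    proof (rule DERIV_isconst2[of x "-R"])
      show "continuous_on {x..-R} h"
        using h by (meson DERIV_isCont continuous_at_imp_continuous_on)
    qed (use lt h0 R(1) in auto)
    then show ?thesis by (simp add: h_def)
  qed
  then have "supp h \<subseteq> {-R..R}"
    by (rule supp_subset_Icc)
  then have "compact (supp h)"
    by (rule compact_supp_subset[rotated]) simp
  moreover have dh: "deriv h = ?c"
    using h by (intro ext DERIV_imp_deriv)
  \<comment> \<open>From order one on, the derivatives of \<open>h\<close> are those of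
    \<open>\<eta>\<close> shifted by one; only order zero needs \<open>h\<close> itself.\<close>
  moreover have "smooth h"
    unfolding smooth_def
  proof
    fix k
    show "(deriv ^^ k) h differentiable_on UNIV"
    proof (cases k)
      case 0
      then show ?thesis
        using h real_differentiable_def by (auto simp: differentiable_on_def)
    next
      case (Suc j)
      then show ?thesis
        using test_apply[of \<eta>] by (simp only: Suc deriv_power_Suc[symmetric] dh) (simp add: smooth_def)
    qed
  qed
  ultimately have "test_apply (test_deriv (Abs_test_fun h)) = ?c"
    by (simp add: test_deriv.rep_eq Abs_test_fun_inverse)
  then show ?thesis
    by (intro that[of "Abs_test_fun h"]) (simp add: test_apply_inject)
qed

text \<open>A nonnegative bump around \<open>y\<close>, scaled to mass one, turns the integral into
  a weighted average of values of \<open>F\<close> that continuity keeps within \<open>e\<close> of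
  \<open>F y\<close>.\<close>

lemma test_approx_point:
  assumes F: "continuous_on UNIV F" and e: "e > 0"
  obtains \<phi> where "(\<integral>x. test_apply \<phi> x \<partial>lebesgue) = 1"
    "\<bar>(\<integral>x. F x * test_apply \<phi> x \<partial>lebesgue) - F y\<bar> \<le> e"
proof -
  obtain d where d: "d > 0" "\<And>x. \<bar>x - y\<bar> < d \<Longrightarrow> \<bar>F x - F y\<bar> < e"
    using F e unfolding continuous_on_iff dist_real_def by (metis UNIV_I)
  obtain \<theta> where \<theta>: "\<And>x. 0 \<le> test_apply \<theta> x" "\<And>x. test_apply \<theta> x \<noteq> 0 \<longleftrightarrow> x \<in> {y - d<..<y + d}"
    using ex_nonneg_test_fun[of "y - d" "y + d"] d(1) by auto
  define I where "I = (\<integral>x. test_apply \<theta> x \<partial>lebesgue)"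
  \<comment> \<open>A nonnegative function with integral zero vanishes almost everywhere, but
    \<open>\<theta>\<close> is nonzero on a nonempty open interval, which is not negligible.\<close>
  have "I \<noteq> 0"
  proof
    assume "I = 0"
    then have "AE x in lebesgue. test_apply \<theta> x = 0"
      using \<theta>(1) by (simp add: I_def integral_nonneg_eq_0_iff_AE integrable_test)
    moreover have "{x \<in> space lebesgue. test_apply \<theta> x \<noteq> 0} = {y - d<..<y + d}"
      by (simp only: \<theta>(2)) auto
    ultimately have "{y - d<..<y + d} \<in> null_sets lebesgue"
      by (subst (asm) AE_iff_null) auto
    then have "negligible {y - d<..<y + d}"
      by (simp add: negligible_iff_null_sets)
    then show False
      using open_not_negligible[of "{y - d<..<y + d}"] d(1) by auto
  qed
  moreover have "I \<ge> 0" unfolding I_def by (rule integral_nonneg_AE) (simp add: \<theta>)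
  ultimately have I: "I > 0" by simp
  define \<phi> where "\<phi> = (1 / I) *\<^sub>R \<theta>"
  have app: "test_apply \<phi> x = test_apply \<theta> x / I" for x
    by (simp add: \<phi>_def scaleR_test_fun.rep_eq)
  have one: "(\<integral>x. test_apply \<phi> x \<partial>lebesgue) = 1"
    using I by (simp add: app flip: I_def)
  have intF: "integrable lebesgue (\<lambda>x. F x * test_apply \<phi> x)"
    using F by (intro integrable_mult_test continuous_imp_locally_integrable)
  \<comment> \<open>As \<open>\<phi>\<close> has mass one, the constant \<open>F y\<close> equals
    its own average and can be moved under the integral.\<close>
  have "(\<integral>x. F x * test_apply \<phi> x \<partial>lebesgue) - F y
        = (\<integral>x. F x * test_apply \<phi> x - F y * test_apply \<phi> x \<partial>lebesgue)"
    using one by (subst Bochner_Integration.integral_diff) (auto intro: intF integrable_mult_right integrable_test)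
  also have "\<bar>\<dots>\<bar> \<le> (\<integral>x. e * test_apply \<phi> x \<partial>lebesgue)"
  proof -
    have le: "norm (F x * test_apply \<phi> x - F y * test_apply \<phi> x) \<le> e * test_apply \<phi> x" for x
    proof (cases "\<bar>x - y\<bar> < d")
      case True
      then have "\<bar>F x - F y\<bar> * test_apply \<phi> x \<le> e * test_apply \<phi> x"
        using d(2)[OF True] \<theta>(1)[of x] I by (intro mult_right_mono) (auto simp: app)
      then show ?thesis
        using \<theta>(1)[of x] I by (simp only: left_diff_distrib[symmetric] real_norm_def abs_mult) (simp add: app)
    next
      case False
      then have "test_apply \<theta> x = 0" using \<theta>(2)[of x] by auto
      then show ?thesis by (simp add: app)
    qed
    show ?thesis
      unfolding real_norm_def[symmetric] using intF integrable_test[of \<phi>]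
      by (intro Bochner_Integration.integral_norm_bound_integral le) auto
  qed
  also have "\<dots> = e" using one by simp
  finally show ?thesis using one that by blast
qed

lemma distr_deriv_zero_imp_const:
  assumes F: "continuous_on UNIV F" and 0: "distr_deriv (distr_of_fun F) = 0"
  shows "F x = F y"
proof -
  have F0: "(\<integral>x. F x * test_apply \<eta> x \<partial>lebesgue) = 0" if \<eta>: "(\<integral>x. test_apply \<eta> x \<partial>lebesgue) = 0" for \<eta>
  proof -
    obtain \<psi> where "test_deriv \<psi> = \<eta>"
      using test_fun_integral_zero_imp_deriv[OF \<eta>] by metis
    moreover have "distr_apply (distr_deriv (distr_of_fun F)) \<psi> = 0"
      by (simp add: 0 zero_distribution.rep_eq)
    ultimately show ?thesis
      using F by (simp add: distr_deriv.rep_eq distr_of_fun_continuous)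
  qed
  have "\<bar>F x - F y\<bar> \<le> e" if e: "e > 0" for e
  proof -
    obtain \<phi> where \<phi>: "(\<integral>t. test_apply \<phi> t \<partial>lebesgue) = 1"
        "\<bar>(\<integral>t. F t * test_apply \<phi> t \<partial>lebesgue) - F x\<bar> \<le> e / 2"
      by (rule test_approx_point[OF F half_gt_zero[OF e], of x])
    obtain \<psi> where \<psi>: "(\<integral>t. test_apply \<psi> t \<partial>lebesgue) = 1"
        "\<bar>(\<integral>t. F t * test_apply \<psi> t \<partial>lebesgue) - F y\<bar> \<le> e / 2"
      by (rule test_approx_point[OF F half_gt_zero[OF e], of y])
    have "(\<integral>t. test_apply (\<phi> - \<psi>) t \<partial>lebesgue) = 0"
      using \<phi>(1) \<psi>(1) by (simp add: minus_test_fun.rep_eq integrable_test)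
    then have "(\<integral>t. F t * test_apply (\<phi> - \<psi>) t \<partial>lebesgue) = 0" by (rule F0)
    then have "(\<integral>t. F t * test_apply \<phi> t \<partial>lebesgue) = (\<integral>t. F t * test_apply \<psi> t \<partial>lebesgue)"
      using F by (simp add: minus_test_fun.rep_eq right_diff_distrib integrable_mult_test
          continuous_imp_locally_integrable)
    then show ?thesis using \<phi>(2) \<psi>(2) by linarith
  qed
  then have "\<bar>F x - F y\<bar> \<le> 0"
    by (rule dense_ge)
  then show ?thesis by simp
qed

subsection \<open>Primitives\<close>

text \<open>Continuity matters: \<open>distr_of_fun\<close> sends functions that are not locally
  integrable to zero, so it is not linear on all functions. The two-coefficient form covers sums,
  differences and multiples at once.\<close>

lemma distr_deriv_lincomb:
  assumes "continuous_on UNIV F" "continuous_on UNIV G"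
  shows "distr_deriv (distr_of_fun (\<lambda>x. a * F x + b * G x))
    = a *\<^sub>R distr_deriv (distr_of_fun F) + b *\<^sub>R distr_deriv (distr_of_fun G)"
proof -
  have c: "continuous_on UNIV (\<lambda>x. a * F x + b * G x)"
    using assms by (intro continuous_intros)
  have "distr_apply (distr_deriv (distr_of_fun (\<lambda>x. a * F x + b * G x))) \<phi>
     = distr_apply (a *\<^sub>R distr_deriv (distr_of_fun F) + b *\<^sub>R distr_deriv (distr_of_fun G)) \<phi>" for \<phi>
    using assms c integrable_mult_test continuous_imp_locally_integrable
    by (simp add: distr_deriv.rep_eq plus_distribution.rep_eq scaleR_distribution.rep_eq
        distr_of_fun_continuous distrib_right mult.assoc)
  then show ?thesis by (intro distr_apply_inject[THEN iffD1] ext)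
qed

lemma B_C_iff:
  "F \<in> B_C \<longleftrightarrow> continuous_on UNIV F \<and> (F \<longlongrightarrow> 0) at_bot \<and> (\<exists>l. (F \<longlongrightarrow> l) at_top)"
  by (auto simp: B_C_def C0_ext_def)

lemma B_C_lincomb:
  assumes "F \<in> B_C" "G \<in> B_C"
  shows "(\<lambda>x. a * F x + b * G x) \<in> B_C"
proof -
  obtain l m where "(F \<longlongrightarrow> l) at_top" "(G \<longlongrightarrow> m) at_top"
    using assms by (auto simp: B_C_iff)
  then have "((\<lambda>x. a * F x + b * G x) \<longlongrightarrow> a * l + b * m) at_top"
    by (intro tendsto_intros)
  moreover have "((\<lambda>x. a * F x + b * G x) \<longlongrightarrow> a * 0 + b * 0) at_bot"
    using assms by (intro tendsto_intros) (auto simp: B_C_iff)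
  ultimately show ?thesis
    using assms by (auto simp: B_C_iff intro!: continuous_intros)
qed

text \<open>Two candidates differ by a constant, and their common limit zero at minus infinity
  forces that constant to be zero. Hence the description in \<open>primitive\<close> is well
  defined.\<close>

lemma primitive_eq:
  assumes "F \<in> B_C"
  shows "primitive (distr_deriv (distr_of_fun F)) = F"
  unfolding primitive_def
proof (rule the_equality)
  fix G assume G: "G \<in> B_C \<and> distr_deriv (distr_of_fun G) = distr_deriv (distr_of_fun F)"
  define H where "H = (\<lambda>x. 1 * G x + (-1) * F x)"
  have "H \<in> B_C" unfolding H_def using G assms by (intro B_C_lincomb) auto
  then have cont: "continuous_on UNIV H" and lim: "(H \<longlongrightarrow> 0) at_bot" by (auto simp: B_C_iff)
  have "distr_deriv (distr_of_fun H) = 0"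
    unfolding H_def by (subst distr_deriv_lincomb) (use G assms in \<open>auto simp: B_C_iff\<close>)
  from distr_deriv_zero_imp_const[OF cont this] have "H = (\<lambda>_. H x)" for x by blast
  with lim have "H x = 0" for x
    by (metis tendsto_const_iff trivial_limit_at_bot_linorder)
  then show "G = F" by (auto simp: H_def fun_eq_iff)
qed (use assms in simp)

lemma B_C_bounded:
  assumes "F \<in> B_C"
  shows "bdd_above (range (\<lambda>x. \<bar>F x\<bar>))"
proof -
  obtain l where c: "continuous_on UNIV F" and bot: "(F \<longlongrightarrow> 0) at_bot" and top: "(F \<longlongrightarrow> l) at_top"
    using assms by (auto simp: B_C_iff)
  obtain u where u: "\<And>x. x \<le> u \<Longrightarrow> \<bar>F x\<bar> < 1"
    using tendstoD[OF bot, of 1] by (auto simp: eventually_at_bot_linorder dist_real_def)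
  obtain v where v: "\<And>x. x \<ge> v \<Longrightarrow> \<bar>F x - l\<bar> < 1"
    using tendstoD[OF top, of 1] by (auto simp: eventually_at_top_linorder dist_real_def)
  have "bounded (F ` {u..v})"
    using c by (intro compact_imp_bounded compact_continuous_image) (auto intro: continuous_on_subset)
  then obtain M where M: "\<And>x. x \<in> {u..v} \<Longrightarrow> \<bar>F x\<bar> \<le> M"
    unfolding bounded_iff by (metis imageI real_norm_def)
  \<comment> \<open>The bound 1 on the left tail is absorbed by \<open>\<bar>l\<bar> + 1\<close>. If
    \<open>v < u\<close>, the middle interval is empty and the tails cover the line.\<close>
  have "\<bar>F x\<bar> \<le> max M (\<bar>l\<bar> + 1)" for x
    using u[of x] v[of x] M[of x] by (smt (verit) atLeastAtMost_iff)
  then show ?thesis by (intro bdd_aboveI2)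
qed

lemma alexiewicz_norm_deriv:
  assumes "F \<in> B_C"
  shows "alexiewicz_norm (distr_deriv (distr_of_fun F)) = (SUP x. \<bar>F x\<bar>)"
  by (simp add: alexiewicz_norm_def primitive_eq[OF assms])

lemma primitive_A_C:
  assumes "f \<in> A_C"
  shows "primitive f \<in> B_C" "distr_deriv (distr_of_fun (primitive f)) = f"
  using assms primitive_eq by (auto simp: A_C_def)

text \<open>Taking primitives is linear, so questions about the norm reduce to pointwise statements
  about functions in \<open>B_C\<close>.\<close>

lemma A_C_lincomb:
  assumes "f \<in> A_C" "g \<in> A_C"
  shows "a *\<^sub>R f + b *\<^sub>R g \<in> A_C"
    and "primitive (a *\<^sub>R f + b *\<^sub>R g) = (\<lambda>x. a * primitive f x + b * primitive g x)"
proof -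
  let ?F = "\<lambda>x. a * primitive f x + b * primitive g x"
  have F: "?F \<in> B_C" using assms by (intro B_C_lincomb primitive_A_C)
  have d: "distr_deriv (distr_of_fun ?F) = a *\<^sub>R f + b *\<^sub>R g"
    using assms[THEN primitive_A_C(1)] assms[THEN primitive_A_C(2)]
    by (subst distr_deriv_lincomb) (auto simp: B_C_iff)
  show "a *\<^sub>R f + b *\<^sub>R g \<in> A_C" using F d[symmetric] by (auto simp: A_C_def)
  show "primitive (a *\<^sub>R f + b *\<^sub>R g) = ?F" using primitive_eq[OF F] d by simp
qed

section \<open>The normed space \<open>A_C\<close>\<close>

lemma zero_in_B_C: "(\<lambda>_. 0) \<in> B_C"
  by (auto simp: B_C_iff)

lemma distr_deriv_zero: "distr_deriv (distr_of_fun (\<lambda>_. 0)) = 0"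
  using distr_deriv_lincomb[of "\<lambda>_. 0" "\<lambda>_. 0" 0 0] by simp

text \<open>Together with \<open>alexiewicz_norm_le\<close> this characterises the norm as a least
  upper bound, so later arguments need not handle the supremum. Membership in \<open>A_C\<close>
  supplies the boundedness that makes the supremum meaningful.\<close>

lemma abs_primitive_le:
  assumes "f \<in> A_C"
  shows "\<bar>primitive f x\<bar> \<le> alexiewicz_norm f"
  unfolding alexiewicz_norm_def
  using B_C_bounded[OF primitive_A_C(1)[OF assms]] by (rule cSUP_upper[OF UNIV_I])

lemma alexiewicz_norm_le:
  assumes "\<And>x. \<bar>primitive f x\<bar> \<le> M"
  shows "alexiewicz_norm f \<le> M"
  unfolding alexiewicz_norm_def using assms by (intro cSUP_least) auto

lemma subspace_A_C: "subspace A_C"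
proof (rule subspaceI)
  show "0 \<in> A_C"
    using zero_in_B_C distr_deriv_zero by (force simp: A_C_def)
  show "f + g \<in> A_C" if "f \<in> A_C" "g \<in> A_C" for f g
    using A_C_lincomb(1)[OF that, of 1 1] by simp
  show "c *\<^sub>R f \<in> A_C" if "f \<in> A_C" for c f
    using A_C_lincomb(1)[OF that that, of c 0] by simp
qed

lemma norm_on_A_C: "norm_on A_C alexiewicz_norm"
  unfolding norm_on_def
proof (intro conjI ballI allI)
  fix f assume f: "f \<in> A_C"
  show "0 \<le> alexiewicz_norm f"
    using abs_primitive_le[OF f, of 0] by linarith
  show "alexiewicz_norm f = 0 \<longleftrightarrow> f = 0"
  proof
    assume "alexiewicz_norm f = 0"
    then have "primitive f = (\<lambda>_. 0)"
      using abs_primitive_le[OF f] by (simp add: fun_eq_iff)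
    then show "f = 0"
      using primitive_A_C(2)[OF f] distr_deriv_zero by simp
  next
    assume "f = 0"
    then show "alexiewicz_norm f = 0"
      using alexiewicz_norm_deriv[OF zero_in_B_C] by (simp add: distr_deriv_zero)
  qed
  fix c
  have "primitive (c *\<^sub>R f) = (\<lambda>x. c * primitive f x)"
    using A_C_lincomb(2)[OF f f, of c 0] by simp
  then have scale: "\<bar>primitive (c *\<^sub>R f) x\<bar> = \<bar>c\<bar> * \<bar>primitive f x\<bar>" for x
    by (simp add: abs_mult)
  show "alexiewicz_norm (c *\<^sub>R f) = \<bar>c\<bar> * alexiewicz_norm f"
  proof (rule antisym)
    show "alexiewicz_norm (c *\<^sub>R f) \<le> \<bar>c\<bar> * alexiewicz_norm f"
      by (intro alexiewicz_norm_le) (auto simp: scale intro!: mult_left_mono abs_primitive_le f)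
    have "c *\<^sub>R f \<in> A_C" using f subspace_A_C by (simp add: subspace_scale)
    then have le: "\<bar>c\<bar> * \<bar>primitive f x\<bar> \<le> alexiewicz_norm (c *\<^sub>R f)" and
      pos: "0 \<le> alexiewicz_norm (c *\<^sub>R f)" for x
      using abs_primitive_le[of "c *\<^sub>R f"] scale by (metis, metis abs_ge_zero order_trans)
    \<comment> \<open>The pointwise bound is divided by \<open>\<bar>c\<bar>\<close>; for
      \<open>c = 0\<close> the claim is just nonnegativity.\<close>
    show "\<bar>c\<bar> * alexiewicz_norm f \<le> alexiewicz_norm (c *\<^sub>R f)"
    proof (cases "c = 0")
      case False
      then have "alexiewicz_norm f \<le> alexiewicz_norm (c *\<^sub>R f) / \<bar>c\<bar>"
        using le by (intro alexiewicz_norm_le) (simp add: field_simps)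
      then show ?thesis using False by (simp add: field_simps)
    qed (use pos in simp)
  qed
next
  fix f g assume fg: "f \<in> A_C" "g \<in> A_C"
  have "primitive (f + g) = (\<lambda>x. primitive f x + primitive g x)"
    using A_C_lincomb(2)[OF fg, of 1 1] by simp
  then show "alexiewicz_norm (f + g) \<le> alexiewicz_norm f + alexiewicz_norm g"
    by (intro alexiewicz_norm_le)
       (auto intro: order_trans[OF abs_triangle_ineq] add_mono abs_primitive_le fg)
qed

section \<open>Completeness\<close>

text \<open>Uniform convergence allows limits to be exchanged once the limits \<open>L n\<close> at
  plus infinity are known to converge; they form a Cauchy sequence because \<open>F\<close> is
  uniformly Cauchy. At minus infinity they are all zero.\<close>

lemma B_C_uniform_limit:
  assumes F: "\<And>n. F n \<in> B_C" and lim: "uniform_limit UNIV F G sequentially"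
  shows "G \<in> B_C"
proof -
  obtain L where L: "\<And>n. (F n \<longlongrightarrow> L n) at_top"
    using F unfolding B_C_iff by metis
  have "Cauchy L"
  proof (rule metric_CauchyI)
    fix e :: real assume e: "e > 0"
    have "uniformly_Cauchy_on UNIV F"
      using lim uniformly_convergent_Cauchy uniformly_convergent_on_def by blast
    then obtain M where M: "\<And>m n x. m \<ge> M \<Longrightarrow> n \<ge> M \<Longrightarrow> dist (F m x) (F n x) < e / 2"
      using half_gt_zero[OF e] unfolding uniformly_Cauchy_on_def by (meson UNIV_I)
    \<comment> \<open>Strict inequalities weaken in the limit, so half of \<open>e\<close> is used
      to recover a strict bound.\<close>
    have "dist (L m) (L n) \<le> e / 2" if "m \<ge> M" "n \<ge> M" for m n
      by (rule tendsto_upperbound[OF tendsto_dist[OF L L]])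
         (use M[OF that] in \<open>auto intro!: always_eventually less_imp_le\<close>)
    then show "\<exists>M. \<forall>m\<ge>M. \<forall>n\<ge>M. dist (L m) (L n) < e"
      using e by (intro exI[of _ M]) fastforce
  qed
  then obtain l where l: "L \<longlonglongrightarrow> l"
    using Cauchy_convergent_iff convergent_def by blast
  have "(G \<longlongrightarrow> l) at_top"
    using swap_uniform_limit'[OF _ l lim] L by simp
  moreover have "(G \<longlongrightarrow> 0) at_bot"
    using swap_uniform_limit'[OF _ tendsto_const lim] F by (simp add: B_C_iff)
  moreover have "continuous_on UNIV G"
    using uniform_limit_theorem[OF _ lim] F by (simp add: B_C_iff)
  ultimately show ?thesis by (auto simp: B_C_iff)
qed

text \<open>A Cauchy sequence in the norm has uniformly Cauchy primitives. Their uniform limit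
  \<open>G\<close> lies in \<open>B_C\<close>, and its distributional derivative is the limit
  sought.\<close>

lemma complete_norm_on_A_C: "complete_norm_on A_C alexiewicz_norm"
  unfolding complete_norm_on_def
proof (intro allI impI, elim conjE)
  fix s :: "nat \<Rightarrow> distribution" assume s: "\<forall>n. s n \<in> A_C"
    and cauchy: "\<forall>e>0. \<exists>M. \<forall>m\<ge>M. \<forall>n\<ge>M. alexiewicz_norm (s m - s n) < e"
  define F where "F = (\<lambda>n. primitive (s n))"
  have diff: "primitive (f - g) x = primitive f x - primitive g x" "f - g \<in> A_C"
    if "f \<in> A_C" "g \<in> A_C" for f g x
    using A_C_lincomb[OF that, of 1 "-1"] by simp_all
  have "uniformly_Cauchy_on UNIV F"
  proof (rule uniformly_Cauchy_onI)
    fix e :: real assume "e > 0"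
    then obtain M where M: "\<And>m n. m \<ge> M \<Longrightarrow> n \<ge> M \<Longrightarrow> alexiewicz_norm (s m - s n) < e"
      using cauchy by meson
    have "dist (F m x) (F n x) < e" if "m \<ge> M" "n \<ge> M" for m n x
      using abs_primitive_le[of "s m - s n" x] M[OF that] s diff by (simp add: F_def dist_real_def)
    then show "\<exists>M. \<forall>x\<in>UNIV. \<forall>m\<ge>M. \<forall>n\<ge>M. dist (F m x) (F n x) < e" by blast
  qed
  then obtain G where lim: "uniform_limit UNIV F G sequentially"
    using Cauchy_uniformly_convergent uniformly_convergent_on_def by blast
  have G: "G \<in> B_C"
    by (rule B_C_uniform_limit[OF _ lim]) (use s primitive_A_C(1) in \<open>simp add: F_def\<close>)
  define g where "g = distr_deriv (distr_of_fun G)"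
  have g: "g \<in> A_C" using G by (auto simp: A_C_def g_def)
  have pg: "primitive g = G" using G by (simp add: g_def primitive_eq)
  have "(\<lambda>n. alexiewicz_norm (s n - g)) \<longlonglongrightarrow> 0"
  proof (rule LIMSEQ_I)
    fix e :: real assume e: "e > 0"
    obtain M where M: "\<And>n x. n \<ge> M \<Longrightarrow> \<bar>F n x - G x\<bar> < e / 2"
      using uniform_limitD[OF lim half_gt_zero[OF e]] by (auto simp: eventually_sequentially dist_real_def)
    have "norm (alexiewicz_norm (s n - g) - 0) < e" if "n \<ge> M" for n
    proof -
      \<comment> \<open>Passing to the supremum loses strictness, hence the choice of
        \<open>M\<close> for half of \<open>e\<close>.\<close>
      have "alexiewicz_norm (s n - g) \<le> e / 2"
        using M[OF that] s g by (intro alexiewicz_norm_le) (simp add: diff pg F_def less_imp_le)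
      moreover have "0 \<le> alexiewicz_norm (s n - g)"
        using norm_on_A_C diff(2) s g by (simp add: norm_on_def)
      ultimately show ?thesis using e by simp
    qed
    then show "\<exists>M. \<forall>n\<ge>M. norm (alexiewicz_norm (s n - g) - 0) < e" by blast
  qed
  then show "\<exists>l\<in>A_C. (\<lambda>n. alexiewicz_norm (s n - l)) \<longlonglongrightarrow> 0" using g by blast
qed

theorem theorem2:
  shows "banach_space_on A_C alexiewicz_norm"
  using subspace_A_C norm_on_A_C complete_norm_on_A_C by (simp add: banach_space_on_def)

end
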